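(* Let $\vartheta$ be a primitive random substitution with RS-subshift $(X_\vartheta,S)$. Then either $\operatorname{Per}(X_\vartheta)$ is empty or $\operatorname{Per}(X_\vartheta)$ is a dense subset of $X_\vartheta$, where $\operatorname{Per}(X_\vartheta)=\{x\in X_\vartheta : S^m(x)=x \text{ for some } m>0\}$.
   Context: Let $\mathcal A=\{a_1,\dots,a_n\}$ be a finite alphabet, $\mathcal A^+$ the set of non-empty finite words over $\mathcal A$, and $\mathcal A^{\mathbb Z}$ the set of bi-infinite sequences with the product topology ($\mathcal A$ discrete). A random substitution (non-degenerate; the probabilities, all non-zero, play no role here and are suppressed) is a map $\vartheta$ assigning to each letter $a_i$ a non-empty finite set $\vartheta(a_i)\subset\mathcal A^+$ of realisations. A realisation of $\vartheta(u)$, for $u=u_1\cdots u_m\in\mathcal A^+$, is a word $x_1\cdots x_m$ with each $x_j\in\vartheta(u_j)$ chosen independently for each position. Realisations of $\vartheta^k(u)$ are defined inductively: $\vartheta^0$ is the identity, and the realisations of $\vartheta^{k+1}(u)$ are the realisations of $\vartheta(v)$ for $v$ a realisation of $\vartheta^k(u)$. $\vartheta$ is primitive if there is $k\in\mathbb N$ such that for all $1\le i,j\le n$ the letter $a_i$ is a subword of some realisation of $\vartheta^k(a_j)$. A word $u\in\mathcal A^+$ is $\vartheta$-legal if it is a subword of some realisation of $\vartheta^k(a_j)$ for some $k\in\mathbb N$ and some $j$. The RS-subshift is $X_\vartheta=\{w\in\mathcal A^{\mathbb Z}: \text{every finite non-empty subword of } w \text{ is } \vartheta\text{-legal}\}$,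 with the shift $S(w)_i=w_{i+1}$. *)

theory Defs
  imports "HOL-Analysis.Analysis" "HOL-Library.Sublist"
begin

text \<open>The finite alphabet is a type of class \<open>finite\<close>. Words are lists, and the subword
  relation is \<^const>\<open>sublist\<close> (contiguous factors).\<close>

definition random_substitution :: "('a::finite \<Rightarrow> 'a list set) \<Rightarrow> bool" where
  "random_substitution \<theta> \<longleftrightarrow> (\<forall>a. \<theta> a \<noteq> {} \<and> finite (\<theta> a) \<and> [] \<notin> \<theta> a)"

definition realisations :: "('a::finite \<Rightarrow> 'a list set) \<Rightarrow> 'a list \<Rightarrow> 'a list set" where
  "realisations \<theta> u = {concat xs |xs. list_all2 (\<lambda>x a. x \<in> \<theta> a) xs u}"

primrec iterated_realisations ::
    "('a::finite \<Rightarrow> 'a list set) \<Rightarrow> nat \<Rightarrow> 'a list \<Rightarrow> 'a list set" where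
  "iterated_realisations \<theta> 0 u = {u}"
| "iterated_realisations \<theta> (Suc k) u = (\<Union>v\<in>iterated_realisations \<theta> k u. realisations \<theta> v)"

definition primitive :: "('a::finite \<Rightarrow> 'a list set) \<Rightarrow> bool" where
  "primitive \<theta> \<longleftrightarrow>
    (\<exists>k. \<forall>a b. \<exists>w\<in>iterated_realisations \<theta> k [b]. sublist [a] w)"

definition legal :: "('a::finite \<Rightarrow> 'a list set) \<Rightarrow> 'a list \<Rightarrow> bool" where
  "legal \<theta> u \<longleftrightarrow>
    u \<noteq> [] \<and> (\<exists>k a. \<exists>w\<in>iterated_realisations \<theta> k [a]. sublist u w)"

definition rs_subshift :: "('a::finite \<Rightarrow> 'a list set) \<Rightarrow> (int \<Rightarrow> 'a) set" where
  "rs_subshift \<theta> = {w. \<forall>i j. i \<le> j \<longrightarrow> legal \<theta> (map w [i..j])}"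

definition shift :: "(int \<Rightarrow> 'a) \<Rightarrow> int \<Rightarrow> 'a" where
  "shift w = (\<lambda>i. w (i + 1))"

definition periodic_points :: "(int \<Rightarrow> 'a) set \<Rightarrow> (int \<Rightarrow> 'a) set" where
  "periodic_points X = {x \<in> X. \<exists>m>0. (shift ^^ m) x = x}"

definition full_shift_topology :: "(int \<Rightarrow> 'a::finite) topology" where
  "full_shift_topology = product_topology (\<lambda>_. discrete_topology UNIV) UNIV"

definition dense_subset_of :: "'b topology \<Rightarrow> 'b set \<Rightarrow> bool" where
  "dense_subset_of T D \<longleftrightarrow> D \<subseteq> topspace T \<and> T closure_of D = topspace T"

end

theory Submission
  imports Defs
begin

text \<open>If \<open>v\<close> is a period block of a point of the subshift, then all powers of \<open>v\<close> are legal. Given a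
  legal word \<open>u\<close>, primitivity supplies a power \<open>k\<close> of the substitution and a realisation \<open>r\<close> of
  the \<open>k\<close>-th image of \<open>v\<close> that contains \<open>u\<close>. Realising every copy of \<open>v\<close> by this same \<open>r\<close> shows
  that all powers of \<open>r\<close> are legal, so \<open>u\<close> occurs in the periodic point generated by \<open>r\<close>.\<close>

section \<open>Realisations of concatenations, powers and factors\<close>

lemma realisations_append:
  assumes "x \<in> realisations \<theta> u" "y \<in> realisations \<theta> v"
  shows "x @ y \<in> realisations \<theta> (u @ v)"
proof -
  obtain xs ys where "x = concat xs" "list_all2 (\<lambda>x a. x \<in> \<theta> a) xs u"
    "y = concat ys" "list_all2 (\<lambda>x a. x \<in> \<theta> a) ys v"
    using assms by (auto simp: realisations_def)
  then have "x @ y = concat (xs @ ys)" "list_all2 (\<lambda>x a. x \<in> \<theta> a) (xs @ ys) (u @ v)"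
    by (auto intro: list_all2_appendI)
  then show ?thesis
    unfolding realisations_def by blast
qed

lemma Nil_in_realisations: "[] \<in> realisations \<theta> []"
  by (auto simp: realisations_def)

lemma realisations_nonempty:
  assumes "random_substitution \<theta>"
  shows "realisations \<theta> u \<noteq> {}"
proof -
  have "list_all2 (\<lambda>x a. x \<in> \<theta> a) (map (\<lambda>a. SOME x. x \<in> \<theta> a) u) u"
    using assms by (auto simp: list_all2_conv_all_nth random_substitution_def some_in_eq)
  then show ?thesis
    by (auto simp: realisations_def)
qed

lemma iterated_realisations_append:
  "x \<in> iterated_realisations \<theta> k u \<Longrightarrow> y \<in> iterated_realisations \<theta> k v \<Longrightarrow>
    x @ y \<in> iterated_realisations \<theta> k (u @ v)"
proof (induction k arbitrary: x y)
  case (Suc k)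
  then obtain x' y' where "x' \<in> iterated_realisations \<theta> k u" "x \<in> realisations \<theta> x'"
    "y' \<in> iterated_realisations \<theta> k v" "y \<in> realisations \<theta> y'"
    by auto
  with Suc.IH show ?case
    by (auto intro!: bexI[of _ "x' @ y'"] realisations_append)
qed simp

lemma Nil_in_iterated_realisations: "[] \<in> iterated_realisations \<theta> k []"
  by (induction k) (auto intro: Nil_in_realisations)

lemma iterated_realisations_nonempty:
  assumes "random_substitution \<theta>"
  shows "iterated_realisations \<theta> k u \<noteq> {}"
  using realisations_nonempty[OF assms] by (induction k) auto

lemma iterated_realisations_trans:
  "v \<in> iterated_realisations \<theta> j u \<Longrightarrow> w \<in> iterated_realisations \<theta> k v \<Longrightarrow>
    w \<in> iterated_realisations \<theta> (j + k) u"
  by (induction k arbitrary: w) auto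

lemma iterated_realisations_concat_replicate:
  "r \<in> iterated_realisations \<theta> k v \<Longrightarrow>
    concat (replicate n r) \<in> iterated_realisations \<theta> k (concat (replicate n v))"
  by (induction n) (auto intro: iterated_realisations_append Nil_in_iterated_realisations)

text \<open>Positions are realised independently and every word has some realisation, so the parts
  of \<open>w\<close> on either side of \<open>u\<close> can be filled in arbitrarily around
  \<open>r\<close>.\<close>

lemma iterated_realisations_extend:
  assumes "random_substitution \<theta>" "sublist u w" "r \<in> iterated_realisations \<theta> k u"
  obtains s where "s \<in> iterated_realisations \<theta> k w" "sublist r s"
proof -
  obtain p q where w: "w = p @ u @ q"
    using assms(2) by (auto simp: sublist_def)
  obtain p' q' where "p' \<in> iterated_realisations \<theta> k p" "q' \<in> iterated_realisations \<theta> k q"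
    using iterated_realisations_nonempty[OF assms(1)] by blast
  then have "p' @ r @ q' \<in> iterated_realisations \<theta> k w"
    using assms(3) w by (simp add: iterated_realisations_append)
  then show thesis
    by (rule that) simp
qed

section \<open>Legal words under iteration and primitivity\<close>

lemma legal_sublist: "legal \<theta> w \<Longrightarrow> sublist u w \<Longrightarrow> u \<noteq> [] \<Longrightarrow> legal \<theta> u"
  unfolding legal_def by (meson sublist_order.order_trans)

text \<open>The word that witnesses legality of \<open>u\<close> has a realisation containing
  \<open>r\<close>, and the two iteration counts add up.\<close>

lemma legal_iterated_realisation:
  assumes "random_substitution \<theta>" "legal \<theta> u" "r \<in> iterated_realisations \<theta> k u" "r \<noteq> []"
  shows "legal \<theta> r"
proof -
  obtain j a w where w: "w \<in> iterated_realisations \<theta> j [a]" "sublist u w"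
    using assms(2) by (auto simp: legal_def)
  obtain s where "s \<in> iterated_realisations \<theta> k w" "sublist r s"
    using iterated_realisations_extend[OF assms(1) w(2) assms(3)] .
  with w(1) assms(4) show ?thesis
    unfolding legal_def by (blast intro: iterated_realisations_trans)
qed

text \<open>Starting from any \<open>b\<close>, primitivity first produces the letter
  \<open>a\<close> from which \<open>u\<close> arises, and further steps then produce
  \<open>u\<close>. Neither number of steps depends on \<open>b\<close>, so their sum is a common
  exponent.\<close>

lemma primitive_legal_in_every_letter:
  assumes "random_substitution \<theta>" "primitive \<theta>" "legal \<theta> u"
  obtains k where "\<And>b. \<exists>w\<in>iterated_realisations \<theta> k [b]. sublist u w"
proof -
  obtain K where K: "\<And>a b. \<exists>w\<in>iterated_realisations \<theta> K [b]. sublist [a] w"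
    using assms(2) by (auto simp: primitive_def)
  obtain k a w where w: "w \<in> iterated_realisations \<theta> k [a]" "sublist u w"
    using assms(3) by (auto simp: legal_def)
  have "\<exists>s\<in>iterated_realisations \<theta> (K + k) [b]. sublist u s" for b
  proof -
    obtain t where t: "t \<in> iterated_realisations \<theta> K [b]" "sublist [a] t"
      using K by blast
    obtain s where "s \<in> iterated_realisations \<theta> k t" "sublist w s"
      using iterated_realisations_extend[OF assms(1) t(2) w(1)] .
    then show ?thesis
      using t(1) w(2) by (meson iterated_realisations_trans sublist_order.order_trans)
  qed
  then show thesis
    by (rule that)
qed

lemma legal_powers_containing:
  assumes \<theta>: "random_substitution \<theta>" "primitive \<theta>" and "legal \<theta> u"
    and v: "v \<noteq> []" "\<And>n. n > 0 \<Longrightarrow> legal \<theta> (concat (replicate n v))"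
  obtains r where "sublist u r" "\<And>n. n > 0 \<Longrightarrow> legal \<theta> (concat (replicate n r))"
proof -
  obtain k where k: "\<And>b. \<exists>w\<in>iterated_realisations \<theta> k [b]. sublist u w"
    using primitive_legal_in_every_letter[OF \<theta> \<open>legal \<theta> u\<close>] by blast
  obtain w where w: "w \<in> iterated_realisations \<theta> k [hd v]" "sublist u w"
    using k by blast
  have "sublist [hd v] v"
    using v(1) by (cases v) (auto simp: sublist_Cons_right)
  \<comment> \<open>It suffices that the image of one letter of \<open>v\<close> contains
    \<open>u\<close>: the image \<open>w\<close> of the first letter is kept, the other letters are
    realised arbitrarily.\<close>
  then obtain r where r: "r \<in> iterated_realisations \<theta> k v" "sublist w r"
    using iterated_realisations_extend[OF \<theta>(1) _ w(1)] by blast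
  have u: "sublist u r"
    using w(2) r(2) by (rule sublist_order.order_trans)
  then have "r \<noteq> []"
    using \<open>legal \<theta> u\<close> by (auto simp: legal_def)
  then have "legal \<theta> (concat (replicate n r))" if "n > 0" for n
    using that v(2)[OF that]
    by (intro legal_iterated_realisation[OF \<theta>(1) _ iterated_realisations_concat_replicate[OF r(1)]])
      auto
  with u show thesis
    by (rule that)
qed

section \<open>Periodic sequences and the powers of their period blocks\<close>

lemma length_concat_replicate: "length (concat (replicate n r)) = n * length r"
  by (induction n) auto

lemma nth_concat_replicate:
  "t < n * length r \<Longrightarrow> concat (replicate n r) ! t = r ! (t mod length r)"
proof (induction n arbitrary: t)
  case (Suc n)
  then show ?case
    by (cases "t < length r") (auto simp: nth_append le_mod_geq)
qed simp

lemma shift_funpow: "(shift ^^ m) x i = x (i + int m)"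
  by (induction m arbitrary: i) (auto simp: shift_def algebra_simps)

lemma period_mod:
  assumes "(shift ^^ m) x = x"
  shows "x (int t) = x (int (t mod m))"
proof (induction t rule: less_induct)
  case (less t)
  show ?case
  \<comment> \<open>The case \<open>m = 0\<close> is trivial because \<open>t mod 0 = t\<close>;
    otherwise one period is subtracted.\<close>
  proof (cases "t < m \<or> m = 0")
    case False
    then have "x (int t) = x (int (t - m))"
      using shift_funpow[of m x "int (t - m)"] assms by simp
    with False less[of "t - m"] show ?thesis
      by (simp add: le_mod_geq)
  qed auto
qed

text \<open>Take for \<open>v\<close> the block of \<open>x\<close> on the positions from
  \<open>0\<close> to \<open>m - 1\<close>. By periodicity its powers are themselves factors of
  \<open>x\<close>, hence legal.\<close>

lemma periodic_point_legal_powers: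
  assumes "x \<in> periodic_points (rs_subshift \<theta>)"
  obtains v where "v \<noteq> []" "\<And>n. n > 0 \<Longrightarrow> legal \<theta> (concat (replicate n v))"
proof -
  obtain m where m: "m > 0" "(shift ^^ m) x = x" and x: "x \<in> rs_subshift \<theta>"
    using assms by (auto simp: periodic_points_def)
  define v where "v = map (\<lambda>t. x (int t)) [0..<m]"
  have "legal \<theta> (concat (replicate n v))" if "n > 0" for n
  proof -
    have "concat (replicate n v) = map x [0..int (n * m) - 1]"
    proof (rule nth_equalityI)
      fix t
      assume "t < length (concat (replicate n v))"
      then have "t < n * m"
        by (simp add: length_concat_replicate v_def)
      then have "concat (replicate n v) ! t = x (int (t mod m))"
        using m(1) by (simp add: nth_concat_replicate v_def)
      also have "\<dots> = map x [0..int (n * m) - 1] ! t"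
        using \<open>t < n * m\<close> period_mod[OF m(2), of t]
        by (simp add: nth_upto del: of_nat_mult)
      finally show "concat (replicate n v) ! t = map x [0..int (n * m) - 1] ! t" .
    qed (simp add: length_concat_replicate v_def del: of_nat_mult)
    moreover have "n * m > 0"
      using that m(1) by simp
    then have "0 \<le> int (n * m) - 1"
      by linarith
    ultimately show ?thesis
      using x by (simp add: rs_subshift_def del: of_nat_mult)
  qed
  moreover have "v \<noteq> []"
    using m(1) by (simp add: v_def)
  ultimately show thesis
    using that by blast
qed

text \<open>The bi-infinite repetition of \<open>r\<close> in which one copy starts at position
  \<open>p\<close>. Since \<open>mod\<close> on integers is non-negative for a positive modulus, the
  formula also covers positions left of \<open>p\<close>.\<close>

definition periodic_extension :: "int \<Rightarrow> 'a list \<Rightarrow> int \<Rightarrow> 'a" where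
  "periodic_extension p r i = r ! nat ((i - p) mod int (length r))"

lemma periodic_extension_in_periodic_points:
  assumes r: "r \<noteq> []" "\<And>n. n > 0 \<Longrightarrow> legal \<theta> (concat (replicate n r))"
  shows "periodic_extension p r \<in> periodic_points (rs_subshift \<theta>)"
proof -
  have "legal \<theta> (map (periodic_extension p r) [i..j])" if "i \<le> j" for i j
  proof -
    \<comment> \<open>Here \<open>s\<close> is the offset of position \<open>i\<close> within its
      copy of \<open>r\<close>, and \<open>l\<close> is the length of the window. As
      \<open>r\<close> is non-empty, \<open>s + l\<close> copies are long enough to contain the
      window starting at \<open>s\<close>.\<close>
    define s where "s = nat ((i - p) mod int (length r))"
    define l where "l = nat (j - i + 1)"
    define W where "W = concat (replicate (s + l) r)"
    have int_s: "int s = (i - p) mod int (length r)"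
      using r(1) by (simp add: s_def)
    have "s + l \<le> (s + l) * length r"
      using r(1) by (cases r) auto
    then have len: "s + l \<le> length W"
      by (simp add: W_def length_concat_replicate)
    have "map (periodic_extension p r) [i..j] = take l (drop s W)"
    proof (rule nth_equalityI)
      show "length (map (periodic_extension p r) [i..j]) = length (take l (drop s W))"
        using len by (simp add: l_def)
      fix t
      assume "t < length (map (periodic_extension p r) [i..j])"
      then have t: "t < l" "i + int t \<le> j"
        by (auto simp: l_def)
      have "(i + int t - p) mod int (length r) = (int s + int t) mod int (length r)"
        unfolding int_s by (simp add: mod_simps algebra_simps)
      also have "\<dots> = int ((s + t) mod length r)"
        by (simp add: zmod_int)
      finally have "periodic_extension p r (i + int t) = r ! ((s + t) mod length r)"
        by (simp add: periodic_extension_def)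
      also have "\<dots> = W ! (s + t)"
        unfolding W_def using t(1) \<open>s + l \<le> (s + l) * length r\<close>
        by (intro nth_concat_replicate[symmetric]) linarith
      finally show "map (periodic_extension p r) [i..j] ! t = take l (drop s W) ! t"
        using t len by (simp add: nth_upto)
    qed
    moreover have "sublist (take l (drop s W)) W"
      by (meson sublist_drop sublist_order.order_trans sublist_take)
    moreover have "legal \<theta> W"
      using \<open>i \<le> j\<close> r(2) by (simp add: W_def l_def)
    ultimately show ?thesis
      using \<open>i \<le> j\<close> by (metis legal_sublist map_is_Nil_conv upto_Nil2 upto_Nil not_less)
  qed
  moreover have "(shift ^^ length r) (periodic_extension p r) = periodic_extension p r"
  proof
    fix i
    have "i + int (length r) - p = (i - p) + int (length r)"
      by simp
    then show "(shift ^^ length r) (periodic_extension p r) i = periodic_extension p r i"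
      unfolding shift_funpow periodic_extension_def by (simp only: mod_add_self2)
  qed
  ultimately show ?thesis
    using r(1) by (auto simp: periodic_points_def rs_subshift_def)
qed

text \<open>This is density in combinatorial form: a single periodic point supplies a word with
  legal powers, which is traded for one containing the window of \<open>w\<close>.\<close>

lemma periodic_point_agreeing_on_window:
  assumes \<theta>: "random_substitution \<theta>" "primitive \<theta>"
    and ne: "periodic_points (rs_subshift \<theta>) \<noteq> {}"
    and w: "w \<in> rs_subshift \<theta>" and ij: "i \<le> j"
  obtains y where "y \<in> periodic_points (rs_subshift \<theta>)" "\<And>t. t \<in> {i..j} \<Longrightarrow> y t = w t"
proof -
  have u: "legal \<theta> (map w [i..j])"
    using w ij by (simp add: rs_subshift_def)
  obtain x where "x \<in> periodic_points (rs_subshift \<theta>)"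
    using ne by blast
  then obtain v where "v \<noteq> []" "\<And>n. n > 0 \<Longrightarrow> legal \<theta> (concat (replicate n v))"
    using periodic_point_legal_powers by blast
  then obtain r where r: "sublist (map w [i..j]) r"
    "\<And>n. n > 0 \<Longrightarrow> legal \<theta> (concat (replicate n r))"
    using legal_powers_containing[OF \<theta> u] by blast
  obtain p q where pq: "r = p @ map w [i..j] @ q"
    using r(1) by (auto simp: sublist_def)
  \<comment> \<open>Anchoring a copy of \<open>r\<close> at \<open>i - length p\<close> places the
    occurrence of the window inside \<open>r\<close> exactly at position \<open>i\<close>.\<close>
  define y where "y = periodic_extension (i - int (length p)) r"
  have "r \<noteq> []"
    using pq ij by auto
  then have "y \<in> periodic_points (rs_subshift \<theta>)"
    unfolding y_def using r(2) by (intro periodic_extension_in_periodic_points)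
  moreover have "y t = w t" if "t \<in> {i..j}" for t
  proof -
    \<comment> \<open>The whole window lies in the anchored copy of \<open>r\<close>, so no
      reduction modulo the length takes place.\<close>
    have "(t - (i - int (length p))) mod int (length r) = int (length p) + (t - i)"
      using that pq by (subst mod_pos_pos_trivial) auto
    then have "y t = r ! (length p + nat (t - i))"
      using that by (simp add: y_def periodic_extension_def nat_add_distrib)
    also have "\<dots> = w t"
      using that by (simp add: pq nth_append nth_upto)
    finally show ?thesis .
  qed
  ultimately show thesis
    using that by blast
qed

section \<open>From windows to the product topology\<close>

lemma finite_int_subset_interval:
  assumes "finite (F :: int set)"
  obtains N where "N \<ge> 0" "F \<subseteq> {-N..N}"
proof
  \<comment> \<open>Inserting \<open>0\<close> keeps \<open>Max\<close> meaningful for empty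
    \<open>F\<close> and makes the bound non-negative.\<close>
  show "0 \<le> Max (insert 0 (abs ` F))"
    using assms by simp
  have "\<bar>t\<bar> \<le> Max (insert 0 (abs ` F))" if "t \<in> F" for t
    using assms that by simp
  then show "F \<subseteq> {-Max (insert 0 (abs ` F))..Max (insert 0 (abs ` F))}"
    by (force simp: abs_le_iff)
qed

theorem proposition14:
  fixes \<theta> :: "'a::finite \<Rightarrow> 'a list set"
  assumes "random_substitution \<theta>"
    and "primitive \<theta>"
  shows "periodic_points (rs_subshift \<theta>) = {} \<or>
    dense_subset_of (subtopology full_shift_topology (rs_subshift \<theta>))
      (periodic_points (rs_subshift \<theta>))"
  unfolding disj_imp
proof (rule impI)
  let ?X = "rs_subshift \<theta>" and ?P = "periodic_points (rs_subshift \<theta>)"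
  assume ne: "?P \<noteq> {}"
  have top: "topspace (subtopology full_shift_topology ?X) = ?X"
    by (simp add: full_shift_topology_def)
  have sub: "?P \<subseteq> ?X"
    by (auto simp: periodic_points_def)
  have "\<exists>y\<in>?P. y \<in> T" if w: "w \<in> ?X"
    and T: "openin (subtopology full_shift_topology ?X) T" "w \<in> T" for w T
  proof -
    obtain U where U: "openin full_shift_topology U" "T = U \<inter> ?X"
      using T(1) by (auto simp: openin_subtopology)
    \<comment> \<open>A basic neighbourhood of \<open>w\<close> constrains only finitely many
      coordinates, so agreement with \<open>w\<close> on a large enough symmetric window forces
      membership in it.\<close>
    obtain B where B: "finite {i. B i \<noteq> (UNIV :: 'a set)}" "w \<in> Pi\<^sub>E UNIV B" "Pi\<^sub>E UNIV B \<subseteq> U"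
      using U T(2) unfolding full_shift_topology_def openin_product_topology_alt by auto
    obtain N where N: "N \<ge> 0" "{i. B i \<noteq> UNIV} \<subseteq> {-N..N}"
      using finite_int_subset_interval[OF B(1)] .
    obtain y where y: "y \<in> ?P" "\<And>t. t \<in> {-N..N} \<Longrightarrow> y t = w t"
      using periodic_point_agreeing_on_window[OF assms ne w, of "-N" N] N(1) by auto
    have "y i \<in> B i" for i
    proof (cases "B i = UNIV")
      case False
      then have "y i = w i"
        using y(2) N(2) by blast
      then show ?thesis
        using B(2) by auto
    qed simp
    then have "y \<in> U"
      using B(3) by auto
    with y(1) sub U(2) show ?thesis
      by blast
  qed
  then have "?X \<subseteq> subtopology full_shift_topology ?X closure_of ?P"
    unfolding subset_iff in_closure_of top by blast
  then show "dense_subset_of (subtopology full_shift_topology ?X) ?P"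
    using sub closure_of_subset_topspace[of "subtopology full_shift_topology ?X" ?P]
    unfolding dense_subset_of_def top by blast
qed

end
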